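(* Let $\alpha$ be a set with involution $\tau$, and for $a,b,c\in\alpha$ (not necessarily distinct) let $\mathcal A=\{A,B,C\}$ be the $\alpha$-alphabet with $|A|=a,|B|=b,|C|=c$ and define the nanowords $w^1_{a,b,c}=ABCABC$, $w^2_{a,b,c}=ABCACB$, $w^3_{a,b,c}=ABCBAC$, $w^4_{a,b,c}=ABCBCA$, $w^5_{a,b,c}=ABACBC$. Call a triple $(a,b,c)$ 1-regular if $a\neq\tau(b)\neq c$; 2-regular if $c\neq\tau(b)$; 3-regular if $a\neq\tau(b)$; 4-regular if $c\neq\tau(b)$; 5-regular unless $a=b=c=\tau(a)$. Then: (i) for $i=1,\dots,5$ and any $i$-regular triple $(a,b,c)$, the nanoword $w^i_{a,b,c}$ is neither contractible nor homotopic to a nanoword of length 4; (ii) for $i$-regular triples $(a,b,c)$ and $(a',b',c')$, $w^i_{a,b,c}$ and $w^i_{a',b',c'}$ are homotopic if and only if $a=a'$, $b=b'$, $c=c'$; (iii) for $i\neq j$, the nanowords $w^i$ corresponding to $i$-regular triples are not homotopic to the nanowords $w^j$ corresponding to $j$-regular triples, with one exception: $w^4_{a,b,c}\simeq w^5_{a,b,c}$ when $a=b=c\neq\tau(a)$.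
   Context: Fix a set $\alpha$ with an involution $\tau:\alpha\to\alpha$. An $\alpha$-alphabet is a set $\mathcal A$ with a map $\mathcal A\to\alpha$, $A\mapsto|A|$. A nanoword over $\alpha$ is a pair $(\mathcal A,w)$ where $\mathcal A$ is a finite $\alpha$-alphabet and $w$ is a word in the letters of $\mathcal A$ in which every letter of $\mathcal A$ occurs exactly twice; its length is the length of $w$. Two nanowords $(\mathcal A_1,w_1),(\mathcal A_2,w_2)$ are isomorphic if there is a bijection $f:\mathcal A_1\to\mathcal A_2$ with $|f(A)|=|A|$ for all $A$ and $w_2$ is obtained from $w_1$ by applying $f$ letterwise. Homotopy moves (here $x,y,z,t$ are words in the remaining letters, and smaller alphabets carry the restricted projection): (1) $(\mathcal A,xAAy)\mapsto(\mathcal A\setminus\{A\},xy)$; (2) $(\mathcal A,xAByBAz)\mapsto(\mathcal A\setminus\{A,B\},xyz)$ whenever $|B|=\tau(|A|)$; (3) $(\mathcal A,xAByACzBCt)\mapsto(\mathcal A,xBAyCAzCBt)$ whenever $A,B,C$ are distinct and $|A|=|B|=|C|$. Homotopy ($\simeq$) is the equivalence relation on nanowords generated by isomorphisms, these moves and their inverses. A nanoword is contractible if it is homotopic to the empty nanoword. *)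

theory Defs
  imports Main
begin

text \<open>Nanowords over alpha (the type 'a). Letters are natural numbers; a nanoword is a
pair (w, p): the word w and the projection p; the alphabet is set w (values of p
outside set w are irrelevant, isomorphism absorbs them).\<close>

type_synonym 'a nanoword = "nat list \<times> (nat \<Rightarrow> 'a)"

definition is_nanoword :: "'a nanoword \<Rightarrow> bool" where
  "is_nanoword u \<longleftrightarrow> (\<forall>A \<in> set (fst u). count_list (fst u) A = 2)"

definition nw_iso :: "'a nanoword \<Rightarrow> 'a nanoword \<Rightarrow> bool" where
  "nw_iso u v \<longleftrightarrow> is_nanoword u \<and> is_nanoword v \<and>
     (\<exists>f. bij_betw f (set (fst u)) (set (fst v)) \<and>
          (\<forall>A \<in> set (fst u). snd v (f A) = snd u A) \<and>
          fst v = map f (fst u))"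

definition nw_move :: "('a \<Rightarrow> 'a) \<Rightarrow> 'a nanoword \<Rightarrow> 'a nanoword \<Rightarrow> bool" where
  "nw_move \<tau> u v \<longleftrightarrow> is_nanoword u \<and> snd v = snd u \<and>
     ((\<exists>x y A. fst u = x @ [A, A] @ y \<and> fst v = x @ y)
    \<or> (\<exists>x y z A B. fst u = x @ [A, B] @ y @ [B, A] @ z \<and> fst v = x @ y @ z
                  \<and> snd u B = \<tau> (snd u A))
    \<or> (\<exists>x y z t A B C. fst u = x @ [A, B] @ y @ [A, C] @ z @ [B, C] @ t
                  \<and> fst v = x @ [B, A] @ y @ [C, A] @ z @ [C, B] @ t
                  \<and> A \<noteq> B \<and> B \<noteq> C \<and> A \<noteq> C
                  \<and> snd u A = snd u B \<and> snd u B = snd u C))"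

definition nw_step :: "('a \<Rightarrow> 'a) \<Rightarrow> 'a nanoword \<Rightarrow> 'a nanoword \<Rightarrow> bool" where
  "nw_step \<tau> u v \<longleftrightarrow> nw_iso u v \<or> nw_move \<tau> u v \<or> nw_move \<tau> v u"

definition homotopic :: "('a \<Rightarrow> 'a) \<Rightarrow> 'a nanoword \<Rightarrow> 'a nanoword \<Rightarrow> bool" where
  "homotopic \<tau> u v \<longleftrightarrow> (nw_step \<tau>)\<^sup>*\<^sup>* u v"

definition contractible :: "('a \<Rightarrow> 'a) \<Rightarrow> 'a nanoword \<Rightarrow> bool" where
  "contractible \<tau> u \<longleftrightarrow> (\<exists>p. homotopic \<tau> u ([], p))"

definition abc_proj :: "'a \<Rightarrow> 'a \<Rightarrow> 'a \<Rightarrow> nat \<Rightarrow> 'a" where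
  "abc_proj a b c n = (if n = 0 then a else if n = 1 then b else c)"

definition wabc :: "nat \<Rightarrow> 'a \<Rightarrow> 'a \<Rightarrow> 'a \<Rightarrow> 'a nanoword" where
  "wabc i a b c =
    ((if i = 1 then [0,1,2,0,1,2]
      else if i = 2 then [0,1,2,0,2,1]
      else if i = 3 then [0,1,2,1,0,2]
      else if i = 4 then [0,1,2,1,2,0]
      else [0,1,0,2,1,2]), abc_proj a b c)"

definition regular :: "('a \<Rightarrow> 'a) \<Rightarrow> nat \<Rightarrow> 'a \<Rightarrow> 'a \<Rightarrow> 'a \<Rightarrow> bool" where
  "regular \<tau> i a b c =
    (if i = 1 then a \<noteq> \<tau> b \<and> \<tau> b \<noteq> c
     else if i = 2 then c \<noteq> \<tau> b
     else if i = 3 then a \<noteq> \<tau> b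
     else if i = 4 then c \<noteq> \<tau> b
     else \<not> (a = b \<and> b = c \<and> c = \<tau> a))"

end

(*
  Homotopy invariants are obtained by reading a nanoword with an automaton: a letter of type a
  changes the state s to F a s at its first occurrence, where s is remembered, and to G a t s at its
  second occurrence, where t is the state then current.  The homotopy moves become equations
  between F and G; the third one is a Yang-Baxter equation that involves a single type a, so that
  F and G may be chosen independently on different orbits of the involution.

  If a, b, c lie in three different orbits, the invariant with values in the group generated by the
  types with x * tau x = 1 suffices: the words w^i are then reduced as they stand, and a word of
  length at most 6 with the same value coincides with them.  Otherwise a, b, c lie in two orbits,
  and an automaton acting on pairs of integers separates the finitely many words over two orbits.
  It uses quandles with an automorphism phi, G a t s being phi^(-1) t acted on by s: symplectic
  transvections on free orbits, and point reflections (one of them conjugated by a shear) on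
  fixed points of the involution.
*)

theory Submission
  imports Defs
begin

section \<open>Automata reading nanowords\<close>

fun read_letter ::
  "('a \<Rightarrow> 's \<Rightarrow> 's) \<Rightarrow> ('a \<Rightarrow> 's \<Rightarrow> 's \<Rightarrow> 's) \<Rightarrow> (nat \<Rightarrow> 'a) \<Rightarrow> nat
     \<Rightarrow> (nat \<rightharpoonup> 's) \<times> 's \<Rightarrow> (nat \<rightharpoonup> 's) \<times> 's" where
  "read_letter F G p A (m, s) =
     (case m A of None \<Rightarrow> (m(A \<mapsto> s), F (p A) s) | Some r \<Rightarrow> (m, G (p A) s r))"

abbreviation "read_word F G p \<equiv> fold (read_letter F G p)"

definition final_state ::
  "('a \<Rightarrow> 's \<Rightarrow> 's) \<Rightarrow> ('a \<Rightarrow> 's \<Rightarrow> 's \<Rightarrow> 's) \<Rightarrow> 'a nanoword \<Rightarrow> 's \<Rightarrow> 's" where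
  "final_state F G u s = snd (read_word F G (snd u) (fst u) (Map.empty, s))"

text \<open>Used with \<open>K\<close> the set of letters displaced by a move: a stretch of the word
  avoiding \<open>K\<close> never consults the memory on \<open>K\<close>, so both sides of the move
  read it alike, and what was remembered for \<open>K\<close> survives to the end of the
  stretch.\<close>

lemma read_word_agree:
  assumes "set w \<inter> K = {}" and "\<forall>L. L \<notin> K \<longrightarrow> m L = m' L"
  shows "snd (read_word F G p w (m, s)) = snd (read_word F G p w (m', s)) \<and>
    (\<forall>L. L \<notin> K \<longrightarrow> fst (read_word F G p w (m, s)) L = fst (read_word F G p w (m', s)) L) \<and>
    (\<forall>L \<in> K. fst (read_word F G p w (m, s)) L = m L)"
  using assms
proof (induction w arbitrary: m m' s)
  case (Cons A w)
  then have A: "A \<notin> K" "m A = m' A" and w: "set w \<inter> K = {}" by auto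
  show ?case
  proof (cases "m A")
    case None
    have "\<forall>L. L \<notin> K \<longrightarrow> (m(A \<mapsto> s)) L = (m'(A \<mapsto> s)) L" using Cons.prems(2) by auto
    from Cons.IH[OF w this, of "F (p A) s"] show ?thesis using None A by (auto simp: fun_upd_def)
  next
    case (Some r)
    from Cons.IH[OF w Cons.prems(2), of "G (p A) s r"] show ?thesis using Some A by auto
  qed
qed auto

lemma read_word_unread: "L \<notin> set w \<Longrightarrow> fst (read_word F G p w (m, s)) L = m L"
  using read_word_agree[of w "{L}" m m] by auto

lemma read_word_map:
  assumes "inj_on f S" and "\<forall>A \<in> S. q (f A) = p A"
    and "set w \<subseteq> S" and "\<forall>A \<in> S. m' (f A) = m A"
  shows "snd (read_word F G q (map f w) (m', s)) = snd (read_word F G p w (m, s))"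
  using assms(3,4)
proof (induction w arbitrary: m m' s)
  case (Cons A w)
  then have A: "A \<in> S" "q (f A) = p A" "m' (f A) = m A" and w: "set w \<subseteq> S"
    using assms(2) by auto
  show ?case
  proof (cases "m A")
    case None
    have "\<forall>B \<in> S. (m'(f A \<mapsto> s)) (f B) = (m(A \<mapsto> s)) B"
      using Cons.prems(2) A(1) assms(1) by (auto dest: inj_onD)
    from Cons.IH[OF w this] show ?thesis using None A by (simp add: fun_upd_def)
  next
    case (Some r)
    from Cons.IH[OF w Cons.prems(2)] show ?thesis using Some A by simp
  qed
qed simp

lemma final_state_iso:
  assumes "nw_iso u v"
  shows "final_state F G u s = final_state F G v s"
proof -
  from assms obtain f where f: "bij_betw f (set (fst u)) (set (fst v))"
    "\<forall>A \<in> set (fst u). snd v (f A) = snd u A" "fst v = map f (fst u)"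
    unfolding nw_iso_def by blast
  show ?thesis
    unfolding final_state_def f(3)
    by (rule read_word_map[OF bij_betw_imp_inj_on[OF f(1)] f(2), symmetric]) auto
qed

text \<open>The axioms sort by moves. \<open>G_F_self\<close> serves move (1);
  \<open>F_involution\<close> and \<open>G_involution\<close> serve move (2), the former at the
  block \<open>AB\<close>, the latter at \<open>BA\<close>; \<open>F_G_distrib\<close> and
  \<open>G_G_distrib\<close> serve move (3), at the blocks containing the first and the second
  occurrence of \<open>C\<close>. Restricting the states to \<open>X\<close> admits normal forms of
  group elements as states.\<close>

locale nanoword_automaton =
  fixes \<tau> :: "'a \<Rightarrow> 'a" and X :: "'s set"
    and F :: "'a \<Rightarrow> 's \<Rightarrow> 's" and G :: "'a \<Rightarrow> 's \<Rightarrow> 's \<Rightarrow> 's"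
  assumes F_closed: "x \<in> X \<Longrightarrow> F a x \<in> X"
    and G_closed: "\<lbrakk>x \<in> X; y \<in> X\<rbrakk> \<Longrightarrow> G a y x \<in> X"
    and G_F_self: "x \<in> X \<Longrightarrow> G a (F a x) x = x"
    and F_involution: "x \<in> X \<Longrightarrow> F (\<tau> a) (F a x) = x"
    and G_involution: "\<lbrakk>x \<in> X; y \<in> X\<rbrakk> \<Longrightarrow> G a (G (\<tau> a) y (F a x)) x = y"
    and F_G_distrib: "\<lbrakk>x \<in> X; y \<in> X\<rbrakk> \<Longrightarrow> F a (G a y x) = G a (F a y) (F a x)"
    and G_G_distrib: "\<lbrakk>x \<in> X; y \<in> X; z \<in> X\<rbrakk>
      \<Longrightarrow> G a (G a z (F a x)) (G a y x) = G a (G a z y) x"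
begin

lemma read_word_closed:
  "\<lbrakk>s \<in> X; ran m \<subseteq> X\<rbrakk> \<Longrightarrow>
    snd (read_word F G p w (m, s)) \<in> X \<and> ran (fst (read_word F G p w (m, s))) \<subseteq> X"
proof (induction w arbitrary: m s)
  case (Cons A w)
  show ?case
  proof (cases "m A")
    case None
    have "ran (m(A \<mapsto> s)) \<subseteq> X" using None Cons.prems by (simp add: ran_map_upd)
    from Cons.IH[OF F_closed[OF Cons.prems(1)] this] None show ?thesis by (simp add: fun_upd_def)
  next
    case (Some r)
    then have "r \<in> X" using Cons.prems(2) by (auto intro: ranI)
    from Cons.IH[OF G_closed[OF this Cons.prems(1)] Cons.prems(2)] Some show ?thesis by simp
  qed
qed simp

lemma read_prefix:
  assumes "s \<in> X"
  obtains m t where "read_word F G p x (Map.empty, s) = (m, t)" "t \<in> X" "ran m \<subseteq> X"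
    "\<And>L. L \<notin> set x \<Longrightarrow> m L = None"
  using read_word_closed[OF assms, of Map.empty p x] read_word_unread[of _ x F G p Map.empty s]
  by (metis empty_subsetI prod.collapse ran_empty)

text \<open>The letters in \<open>K\<close> are those that a move displaces.\<close>

lemma read_word_twin:
  assumes "set y \<inter> K = {}" and "\<forall>L. L \<notin> K \<longrightarrow> m L = m' L" and "s \<in> X" and "ran m \<subseteq> X"
  obtains n n' t where "read_word F G p y (m, s) = (n, t)" "read_word F G p y (m', s) = (n', t)"
    "t \<in> X" "ran n \<subseteq> X" "\<forall>L. L \<notin> K \<longrightarrow> n L = n' L"
    "\<And>L. L \<in> K \<Longrightarrow> n L = m L" "\<And>L. L \<in> K \<Longrightarrow> n' L = m' L"
proof -
  have "\<forall>L. L \<notin> K \<longrightarrow> m' L = m L" using assms(2) by simp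
  from read_word_agree[OF assms(1,2), of F G p s] read_word_agree[OF assms(1) this, of F G p s]
    read_word_closed[OF assms(3,4), of p y]
  show thesis
    by (intro that[of "fst (read_word F G p y (m, s))" "snd (read_word F G p y (m, s))"
          "fst (read_word F G p y (m', s))"]) (auto simp: prod_eq_iff)
qed

lemma read_word_agree_end:
  assumes "set y \<inter> K = {}" and "\<forall>L. L \<notin> K \<longrightarrow> m L = m' L"
  shows "snd (read_word F G p y (m, s)) = snd (read_word F G p y (m', s))"
  using read_word_agree[OF assms, of F G p s] by simp

lemma final_state_move:
  assumes "nw_move \<tau> u v" and s: "s \<in> X"
  shows "final_state F G u s = final_state F G v s"
proof -
  let ?p = "snd u"
  have nw: "\<And>A. A \<in> set (fst u) \<Longrightarrow> count_list (fst u) A = 2" and p: "snd v = ?p"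
    using assms(1) by (auto simp: nw_move_def is_nanoword_def)
  from assms(1) consider
    (1) x y A where "fst u = x @ [A, A] @ y" "fst v = x @ y"
  | (2) x y z A B where "fst u = x @ [A, B] @ y @ [B, A] @ z" "fst v = x @ y @ z"
      "?p B = \<tau> (?p A)"
  | (3) x y z t A B C where "fst u = x @ [A, B] @ y @ [A, C] @ z @ [B, C] @ t"
      "fst v = x @ [B, A] @ y @ [C, A] @ z @ [C, B] @ t" "A \<noteq> B" "B \<noteq> C" "A \<noteq> C"
      "?p A = ?p B" "?p B = ?p C"
    unfolding nw_move_def by blast
  then show ?thesis
  proof cases
    case 1
    have A: "A \<notin> set x" "A \<notin> set y"
      using nw[of A] unfolding 1 by (auto simp: count_list_0_iff)
    obtain m r where m: "read_word F G ?p x (Map.empty, s) = (m, r)" "r \<in> X" "ran m \<subseteq> X"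
      "\<And>L. L \<notin> set x \<Longrightarrow> m L = None" by (rule read_prefix[OF s, where p = ?p and x = x]) blast
    show ?thesis
      unfolding final_state_def p 1
      using m A G_F_self[OF m(2)] read_word_agree_end[of y "{A}" "m(A \<mapsto> r)" m] by simp
  next
    case 2
    have AB: "A \<noteq> B"
      using nw[of A] unfolding 2 by auto
    have A: "A \<notin> set x" "A \<notin> set y" "A \<notin> set z" and B: "B \<notin> set x" "B \<notin> set y" "B \<notin> set z"
      using nw[of A] nw[of B] AB unfolding 2 by (auto simp: count_list_0_iff)
    let ?a = "?p A" and ?K = "{A, B}"
    obtain m r where m: "read_word F G ?p x (Map.empty, s) = (m, r)" "r \<in> X" "ran m \<subseteq> X"
      "\<And>L. L \<notin> set x \<Longrightarrow> m L = None" by (rule read_prefix[OF s, where p = ?p and x = x]) blast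
    \<comment> \<open>By \<open>F_involution\<close> the block \<open>AB\<close> returns to the
      state \<open>r\<close>, so \<open>y\<close> starts from \<open>r\<close> on both sides and
      only the memory of \<open>A\<close> and \<open>B\<close> differs.\<close>
    let ?m = "m(A \<mapsto> r, B \<mapsto> F ?a r)"
    have ran: "ran ?m \<subseteq> X"
      using m A B AB F_closed by (simp add: ran_map_upd)
    have disj: "set y \<inter> ?K = {}" "set z \<inter> ?K = {}" using A B by auto
    have agr: "\<forall>L. L \<notin> ?K \<longrightarrow> ?m L = m L" by simp
    obtain n n' t where n: "read_word F G ?p y (?m, r) = (n, t)"
      "read_word F G ?p y (m, r) = (n', t)" "t \<in> X" "ran n \<subseteq> X" "\<forall>L. L \<notin> ?K \<longrightarrow> n L = n' L"
      "\<And>L. L \<in> ?K \<Longrightarrow> n L = ?m L" "\<And>L. L \<in> ?K \<Longrightarrow> n' L = m L"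
      by (rule read_word_twin[OF disj(1) agr m(2) ran]) blast
    have nA: "n A = Some r" "n B = Some (F ?a r)" using n(6) AB by auto
    show ?thesis
      unfolding final_state_def p 2
      using m(1) m(4)[OF A(1)] m(4)[OF B(1)] AB 2(3) n(1,2) nA F_involution[OF m(2)]
        G_involution[OF m(2) n(3)] read_word_agree_end[OF disj(2) n(5)] by simp
  next
    case 3
    note ABC = 3(3-5)
    have A: "A \<notin> set x" "A \<notin> set y" "A \<notin> set z" "A \<notin> set t"
      using nw[of A] ABC unfolding 3(1) by (auto simp: count_list_0_iff)
    have B: "B \<notin> set x" "B \<notin> set y" "B \<notin> set z" "B \<notin> set t"
      using nw[of B] ABC unfolding 3(1) by (auto simp: count_list_0_iff)
    have C: "C \<notin> set x" "C \<notin> set y" "C \<notin> set z" "C \<notin> set t"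
      using nw[of C] ABC unfolding 3(1) by (auto simp: count_list_0_iff)
    define a where "a = ?p A"
    have pa: "?p A = a" "?p B = a" "?p C = a" using 3(6,7) by (simp_all add: a_def)
    let ?K = "{A, B, C}"
    have disj: "set y \<inter> ?K = {}" "set z \<inter> ?K = {}" "set t \<inter> ?K = {}" using A B C by auto
    obtain m r where m: "read_word F G ?p x (Map.empty, s) = (m, r)" "r \<in> X" "ran m \<subseteq> X"
      "\<And>L. L \<notin> set x \<Longrightarrow> m L = None" by (rule read_prefix[OF s, where p = ?p and x = x]) blast
    \<comment> \<open>\<open>AB\<close> and \<open>BA\<close> lead to the same state because the
      types agree; only the states remembered for \<open>A\<close> and \<open>B\<close> are
      exchanged.\<close>
    let ?m = "m(A \<mapsto> r, B \<mapsto> F a r)" and ?m' = "m(B \<mapsto> r, A \<mapsto> F a r)"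
    have mN: "m A = None" "m B = None" "m C = None" using m(4) A B C by auto
    have ran: "ran ?m \<subseteq> X"
      using m mN ABC F_closed by (simp add: ran_map_upd)
    have agr: "\<forall>L. L \<notin> ?K \<longrightarrow> ?m L = ?m' L" by simp
    have FF: "F a (F a r) \<in> X" using m(2) F_closed by blast
    obtain n n' q where n: "read_word F G ?p y (?m, F a (F a r)) = (n, q)"
      "read_word F G ?p y (?m', F a (F a r)) = (n', q)" "q \<in> X" "ran n \<subseteq> X"
      "\<forall>L. L \<notin> ?K \<longrightarrow> n L = n' L"
      "\<And>L. L \<in> ?K \<Longrightarrow> n L = ?m L" "\<And>L. L \<in> ?K \<Longrightarrow> n' L = ?m' L"
      by (rule read_word_twin[OF disj(1) agr FF ran]) blast
    have nv: "n A = Some r" "n B = Some (F a r)" "n C = None"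
      "n' A = Some (F a r)" "n' B = Some r" "n' C = None"
      using n(6,7) mN ABC by auto
    \<comment> \<open>\<open>C\<close> is met after the second \<open>A\<close> on one side and
      before it on the other, so it remembers \<open>G a q r\<close> and \<open>q\<close>
      respectively. The current state is the same by \<open>F_G_distrib\<close>.\<close>
    let ?n = "n(C \<mapsto> G a q r)" and ?n' = "n'(C \<mapsto> q)"
    have q': "G a q r \<in> X" using G_closed m(2) n(3) by blast
    have ran': "ran ?n \<subseteq> X" using n(4) nv q' by (simp add: ran_map_upd)
    have agr': "\<forall>L. L \<notin> ?K \<longrightarrow> ?n L = ?n' L" using n(5) by simp
    obtain o1 o2 h where o: "read_word F G ?p z (?n, F a (G a q r)) = (o1, h)"
      "read_word F G ?p z (?n', F a (G a q r)) = (o2, h)" "h \<in> X" "ran o1 \<subseteq> X"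
      "\<forall>L. L \<notin> ?K \<longrightarrow> o1 L = o2 L"
      "\<And>L. L \<in> ?K \<Longrightarrow> o1 L = ?n L" "\<And>L. L \<in> ?K \<Longrightarrow> o2 L = ?n' L"
      by (rule read_word_twin[OF disj(2) agr' F_closed[OF q'] ran']) blast
    have ov: "o1 B = Some (F a r)" "o1 C = Some (G a q r)" "o2 B = Some r" "o2 C = Some q"
      using o(6,7) nv ABC by auto
    have "read_word F G ?p (fst u) (Map.empty, s)
        = read_word F G ?p t (o1, G a (G a h (F a r)) (G a q r))"
      unfolding 3(1) using m(1) mN ABC pa n(1) nv o(1) ov by simp
    moreover have "read_word F G ?p (fst v) (Map.empty, s)
        = read_word F G ?p t (o2, G a (G a h q) r)"
      unfolding 3(2) using m(1) mN ABC pa n(2) nv F_G_distrib[OF m(2) n(3)] o(2) ov by simp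
    ultimately show ?thesis
      unfolding final_state_def p
      using G_G_distrib[OF m(2) n(3) o(3)] read_word_agree_end[OF disj(3) o(5)] by simp
  qed
qed

theorem final_state_homotopic:
  assumes "homotopic \<tau> u v" and s: "s \<in> X"
  shows "final_state F G u s = final_state F G v s"
  using assms(1) unfolding homotopic_def
proof (induction rule: rtranclp_induct)
  case (step v w)
  then have "final_state F G v s = final_state F G w s"
    unfolding nw_step_def using final_state_iso[of v w F G s] final_state_move[OF _ s] by metis
  with step.IH show ?case by simp
qed simp

end

section \<open>Values on the words of length six, and the words of length four\<close>

lemma final_state_wabc:
  shows "final_state F G (wabc 1 a b c) s =
      G c (G b (G a (F c (F b (F a s))) s) (F a s)) (F b (F a s))"
    and "final_state F G (wabc 2 a b c) s =
      G b (G c (G a (F c (F b (F a s))) s) (F b (F a s))) (F a s)"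
    and "final_state F G (wabc 3 a b c) s =
      G c (G a (G b (F c (F b (F a s))) (F a s)) s) (F b (F a s))"
    and "final_state F G (wabc 4 a b c) s =
      G a (G c (G b (F c (F b (F a s))) (F a s)) (F b (F a s))) s"
    and "final_state F G (wabc 5 a b c) s =
      G c (G b (F c (G a (F b (F a s)) s)) (F a s)) (G a (F b (F a s)) s)"
  by (simp_all add: final_state_def wabc_def abc_proj_def)


lemma nanoword_length_4:
  assumes "is_nanoword v" and "length (fst v) = 4"
  obtains A B where "A \<noteq> B" "fst v \<in> {[A, B, A, B], [A, A, B, B], [A, B, B, A]}"
proof -
  obtain A x y z where w: "fst v = [A, x, y, z]"
    using assms(2) by (auto simp: numeral_eq_Suc length_Suc_conv)
  have n: "count_list [A, x, y, z] L = 2" if "L \<in> set [A, x, y, z]" for L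
    using assms(1) that unfolding is_nanoword_def w by blast
  show thesis
    using that[of A x] that[of A y] n[of A] n[of x] n[of y] n[of z] w
    by (auto split: if_splits)
qed

section \<open>The invariant in the group of types\<close>

text \<open>Left multiplication by a generator on normal forms of the group with relations
  \<open>x * \<tau> x = 1\<close>, a free product of copies of Z (free orbits) and Z/2 (fixed
  points).\<close>

fun act :: "('a \<Rightarrow> 'a) \<Rightarrow> 'a \<Rightarrow> 'a list \<Rightarrow> 'a list" where
  "act \<tau> a [] = [a]"
| "act \<tau> a (x # xs) = (if x = \<tau> a then xs else a # x # xs)"

definition reduced :: "('a \<Rightarrow> 'a) \<Rightarrow> 'a list set" where
  "reduced \<tau> = {xs. successively (\<lambda>x y. y \<noteq> \<tau> x) xs}"

lemma act_reduced: "xs \<in> reduced \<tau> \<Longrightarrow> act \<tau> a xs \<in> reduced \<tau>"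
  by (cases xs) (auto simp: reduced_def successively_Cons)

lemma act_inverse:
  assumes "\<And>x. \<tau> (\<tau> x) = x" and "xs \<in> reduced \<tau>"
  shows "act \<tau> (\<tau> a) (act \<tau> a xs) = xs"
proof (cases xs)
  case (Cons y ys)
  then show ?thesis using assms by (cases ys) (auto simp: reduced_def)
qed (use assms in simp)

lemma act_inverse':
  assumes "\<And>x. \<tau> (\<tau> x) = x" and "xs \<in> reduced \<tau>"
  shows "act \<tau> a (act \<tau> (\<tau> a) xs) = xs"
  using act_inverse[OF assms, of "\<tau> a"] assms(1) by simp

text \<open>The second occurrence multiplies by the inverse of the type whatever was remembered, so
  every axiom is a cancellation of \<open>a\<close> against \<open>\<tau> a\<close> or an
  identity.\<close>

lemma nanoword_automaton_act:
  assumes "\<And>x. \<tau> (\<tau> x) = x"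
  shows "nanoword_automaton \<tau> (reduced \<tau>) (act \<tau>) (\<lambda>a y x. act \<tau> (\<tau> a) y)"
  by unfold_locales (simp_all add: assms act_reduced act_inverse act_inverse')

lemma length_act: "length (act \<tau> a xs) \<le> Suc (length xs)"
  by (cases xs) auto

lemma length_read_word_act:
  "length (snd (read_word (act \<tau>) (\<lambda>a y x. act \<tau> (\<tau> a) y) p w (m, s))) \<le> length w + length s"
proof (induction w arbitrary: m s)
  case (Cons A w)
  have "length (snd (read_letter (act \<tau>) (\<lambda>a y x. act \<tau> (\<tau> a) y) p A (m, s))) \<le> Suc (length s)"
    using length_act[of \<tau> "p A" s] length_act[of \<tau> "\<tau> (p A)" s] by (simp split: option.split)
  with Cons.IH[of "fst (read_letter (act \<tau>) (\<lambda>a y x. act \<tau> (\<tau> a) y) p A (m, s))"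
      "snd (read_letter (act \<tau>) (\<lambda>a y x. act \<tau> (\<tau> a) y) p A (m, s))"]
  show ?case by simp
qed simp

lemma length_fold_act: "length (fold (act \<tau>) xs ys) \<le> length xs + length ys"
proof (induction xs arbitrary: ys)
  case (Cons x xs)
  show ?case using Cons.IH[of "act \<tau> x ys"] length_act[of \<tau> x ys] by simp
qed simp

text \<open>Each multiplication lengthens the normal form by at most one, so reaching full length
  excludes any cancellation.\<close>

lemma fold_act_full_length:
  "length (fold (act \<tau>) xs []) = length xs \<Longrightarrow> fold (act \<tau>) xs [] = rev xs"
proof (induction xs rule: rev_induct)
  case (snoc x xs)
  let ?s = "fold (act \<tau>) xs []"
  have len: "length (act \<tau> x ?s) = Suc (length xs)" using snoc.prems by simp
  moreover have "length ?s \<le> length xs" using length_fold_act[of \<tau> xs "[]"] by simp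
  ultimately have "length ?s = length xs" using length_act[of \<tau> x ?s] by simp
  with snoc.IH have s: "?s = rev xs" by simp
  with len show ?case by (cases "rev xs") (auto split: if_splits simp flip: length_rev[of xs])
qed simp

text \<open>The generators multiplied along \<open>wabc i a b c\<close>: a letter contributes its
  type first and the inverse of its type the second time.\<close>

definition types_of :: "('a \<Rightarrow> 'a) \<Rightarrow> nat \<Rightarrow> 'a \<Rightarrow> 'a \<Rightarrow> 'a \<Rightarrow> 'a list" where
  "types_of \<tau> i a b c =
     (if i = 1 then [a, b, c, \<tau> a, \<tau> b, \<tau> c]
      else if i = 2 then [a, b, c, \<tau> a, \<tau> c, \<tau> b]
      else if i = 3 then [a, b, c, \<tau> b, \<tau> a, \<tau> c]
      else if i = 4 then [a, b, c, \<tau> b, \<tau> c, \<tau> a]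
      else [a, b, \<tau> a, c, \<tau> b, \<tau> c])"

lemma atLeastAtMost_1_5: "i \<in> {1..5::nat} \<longleftrightarrow> i \<in> {1, 2, 3, 4, 5}"
  by auto

lemma final_state_act_wabc:
  assumes "i \<in> {1..5}"
  shows "final_state (act \<tau>) (\<lambda>a y x. act \<tau> (\<tau> a) y) (wabc i a b c) [] =
    fold (act \<tau>) (types_of \<tau> i a b c) []"
  using assms unfolding atLeastAtMost_1_5
  by (auto simp only: final_state_wabc types_of_def insert_iff empty_iff) (simp_all del: act.simps)

section \<open>Triples in three distinct orbits\<close>

definition three_orbits :: "('a \<Rightarrow> 'a) \<Rightarrow> 'a \<Rightarrow> 'a \<Rightarrow> 'a \<Rightarrow> bool" where
  "three_orbits \<tau> a b c \<longleftrightarrow> b \<notin> {a, \<tau> a} \<and> c \<notin> {a, \<tau> a} \<and> c \<notin> {b, \<tau> b}"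

text \<open>None of the five words has two equal neighbouring letters, so neighbouring generators
  lie in different orbits and nothing cancels.\<close>

lemma fold_act_three_orbits:
  assumes inv: "\<And>x. \<tau> (\<tau> x) = x" and "three_orbits \<tau> a b c"
  shows "fold (act \<tau>) (types_of \<tau> i a b c) [] = rev (types_of \<tau> i a b c)"
proof -
  have "x = \<tau> y \<longleftrightarrow> y = \<tau> x" for x y using inv by metis
  with assms show ?thesis
    by (auto simp: types_of_def three_orbits_def)
qed

text \<open>The common value has length six, so the product for the second word is uncancelled too
  and its generators can be read off. The positions of the inverses then determine the
  index.\<close>

lemma three_orbits_classification:
  assumes inv: "\<And>x. \<tau> (\<tau> x) = x" and "three_orbits \<tau> a b c"
    and ij: "i \<in> {1..5}" "j \<in> {1..5}"
    and hom: "homotopic \<tau> (wabc i a b c) (wabc j a' b' c')"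
  shows "i = j \<and> a = a' \<and> b = b' \<and> c = c'"
proof -
  interpret nanoword_automaton \<tau> "reduced \<tau>" "act \<tau>" "\<lambda>a y x. act \<tau> (\<tau> a) y"
    by (rule nanoword_automaton_act[OF inv])
  let ?u = "types_of \<tau> i a b c" and ?v = "types_of \<tau> j a' b' c'"
  have "fold (act \<tau>) ?u [] = fold (act \<tau>) ?v []"
    using final_state_homotopic[OF hom, of "[]"] ij
    by (simp add: final_state_act_wabc reduced_def del: atLeastAtMost_iff)
  then have uv: "fold (act \<tau>) ?v [] = rev ?u"
    using fold_act_three_orbits[OF assms(1,2)] by simp
  moreover have "length ?u = length ?v" by (simp add: types_of_def)
  ultimately have "?v = ?u" using fold_act_full_length[of \<tau> ?v] by simp
  moreover have "\<tau> x = \<tau> y \<longleftrightarrow> x = y" for x y using inv by metis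
  ultimately show ?thesis
    using ij assms(2) unfolding atLeastAtMost_1_5 three_orbits_def
    by (auto simp: types_of_def)
qed

lemma three_orbits_length:
  assumes inv: "\<And>x. \<tau> (\<tau> x) = x" and "three_orbits \<tau> a b c"
    and i: "i \<in> {1..5}" and hom: "homotopic \<tau> (wabc i a b c) v"
  shows "6 \<le> length (fst v)"
proof -
  interpret nanoword_automaton \<tau> "reduced \<tau>" "act \<tau>" "\<lambda>a y x. act \<tau> (\<tau> a) y"
    by (rule nanoword_automaton_act[OF inv])
  let ?u = "types_of \<tau> i a b c"
  have "final_state (act \<tau>) (\<lambda>a y x. act \<tau> (\<tau> a) y) v [] = rev ?u"
    using final_state_homotopic[OF hom, of "[]"] i fold_act_three_orbits[OF assms(1,2)]
    by (simp add: final_state_act_wabc reduced_def del: atLeastAtMost_iff)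
  moreover have "length ?u = 6" by (simp add: types_of_def)
  ultimately show ?thesis
    using length_read_word_act[of \<tau> "snd v" "fst v" Map.empty "[]"]
    by (simp add: final_state_def)
qed

section \<open>The automaton for two orbits\<close>

text \<open>The matrices and the initial state \<open>(2, -1)\<close> below were found by a computer search; other
  choices separate the words as well.  \<open>Fix1\<close> and \<open>Fix2\<close> replace \<open>Pos\<close> and \<open>Neg\<close> on an orbit
  that is a fixed point; types in further orbits are sent to \<open>Del\<close>, on which the automaton does
  nothing.\<close>

datatype code = Del | Pos1 | Neg1 | Fix1 | Pos2 | Neg2 | Fix2

fun flip :: "code \<Rightarrow> code" where
  "flip Pos1 = Neg1" | "flip Neg1 = Pos1" | "flip Pos2 = Neg2" | "flip Neg2 = Pos2"
| "flip Fix1 = Fix1" | "flip Fix2 = Fix2" | "flip Del = Del"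

text \<open>The automorphisms phi. On free orbits \<open>Pos1\<close> is minus a shear and
  \<open>Pos2\<close> a hyperbolic matrix, both of determinant 1 and hence preserving the symplectic
  form, with inverses \<open>Neg1\<close> and \<open>Neg2\<close>; on fixed points phi is a linear
  involution of determinant -1.\<close>

fun code_first :: "code \<Rightarrow> int \<times> int \<Rightarrow> int \<times> int" where
  "code_first Del (u, v) = (u, v)"
| "code_first Pos1 (u, v) = (- u, u - v)"
| "code_first Neg1 (u, v) = (- u, - u - v)"
| "code_first Pos2 (u, v) = (2 * u + v, u + v)"
| "code_first Neg2 (u, v) = (u - v, 2 * v - u)"
| "code_first Fix1 (u, v) = (- u, v)"
| "code_first Fix2 (u, v) = (u + v, - v)"

fun transvection :: "int \<Rightarrow> int \<times> int \<Rightarrow> int \<times> int \<Rightarrow> int \<times> int" where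
  "transvection k (u, v) (r, s) = (let c = k * (r * v - s * u) in (u + c * r, v + c * s))"

text \<open>\<open>Fix2\<close> is the point reflection in \<open>(r, s)\<close> applied to phi of
  \<open>(u, v)\<close>. \<open>Fix1\<close> is the same with the reflection conjugated by the
  quadratic shear sending \<open>(u, v)\<close> to \<open>(u, v + u * u)\<close>, which commutes
  with its phi; this produces the square term.\<close>

fun code_second :: "code \<Rightarrow> int \<times> int \<Rightarrow> int \<times> int \<Rightarrow> int \<times> int" where
  "code_second Del y x = y"
| "code_second Pos1 y x = transvection 2 (code_first Neg1 y) x"
| "code_second Neg1 y x = transvection (- 2) (code_first Pos1 y) x"
| "code_second Pos2 y x = transvection 1 (code_first Neg2 y) x"
| "code_second Neg2 y x = transvection (- 1) (code_first Pos2 y) x"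
| "code_second Fix1 (u, v) (r, s) = (2 * r + u, 2 * s - v + 2 * ((r + u) * (r + u)))"
| "code_second Fix2 (u, v) (r, s) = (2 * r - u - v, 2 * s + v)"

lemma code_first_Del: "code_first Del x = x"
  by (cases x) simp

text \<open>Writing \<open>T x\<close> for the action of \<open>x\<close>, the axioms follow from
  \<open>T x\<close> fixing \<open>x\<close>, phi conjugating \<open>T x\<close> to
  \<open>T (phi x)\<close>, and \<open>T x\<close> conjugating \<open>T y\<close> to
  \<open>T (T x y)\<close>; opposite codes use inverse actions. For each code they are polynomial
  identities over the integers.\<close>

lemma nanoword_automaton_code: "nanoword_automaton flip UNIV code_first code_second"
proof
  fix a :: code and x y z :: "int \<times> int"
  show "code_second a (code_first a x) x = x"
    by (cases x; cases a) (simp_all add: Let_def algebra_simps)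
  show "code_first (flip a) (code_first a x) = x"
    by (cases x; cases a) (simp_all add: Let_def algebra_simps)
  show "code_second a (code_second (flip a) y (code_first a x)) x = y"
    by (cases x; cases y; cases a) (simp_all add: Let_def algebra_simps)
  show "code_first a (code_second a y x) = code_second a (code_first a y) (code_first a x)"
    by (cases x; cases y; cases a) (simp_all add: Let_def algebra_simps)
  show "code_second a (code_second a z (code_first a x)) (code_second a y x) =
      code_second a (code_second a z y) x"
    by (cases x; cases y; cases z; cases a) (simp_all add: Let_def algebra_simps)
qed simp_all

text \<open>Every axiom involves only one type and its image under the involution, so an equivariant
  map of types transports all of them.\<close>

lemma (in nanoword_automaton) nanoword_automaton_pullback:
  assumes "\<And>x. g (\<sigma> x) = \<tau> (g x)"
  shows "nanoword_automaton \<sigma> X (\<lambda>a. F (g a)) (\<lambda>a. G (g a))"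
  by unfold_locales (simp_all add: assms F_closed G_closed G_F_self F_involution G_involution
    F_G_distrib G_G_distrib)

text \<open>The formulas of \<open>final_state_wabc\<close> from the initial state
  \<open>(2, - 1)\<close>, in executable form with shared intermediate states.\<close>

definition wabc_value :: "nat \<Rightarrow> code \<Rightarrow> code \<Rightarrow> code \<Rightarrow> int \<times> int" where
  "wabc_value i a b c =
    (let F = code_first; G = code_second; x = (2, - 1); y = F a x; z = F b y in
     if i = 1 then G c (G b (G a (F c z) x) y) z
     else if i = 2 then G b (G c (G a (F c z) x) z) y
     else if i = 3 then G c (G a (G b (F c z) y) x) z
     else if i = 4 then G a (G c (G b (F c z) y) z) x
     else let t = G a z x in G c (G b (F c t) y) t)"

lemma final_state_code:
  assumes "i \<in> {1..5}"
  shows "final_state (\<lambda>a. code_first (g a)) (\<lambda>a. code_second (g a)) (wabc i a b c) (2, - 1) =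
    wabc_value i (g a) (g b) (g c)"
  using assms unfolding atLeastAtMost_1_5
  by (auto simp only: final_state_wabc wabc_value_def Let_def insert_iff empty_iff) simp_all

definition same_word where
  "same_word = (\<lambda>(i::nat, a, b, c) (j::nat, a', b', c').
     a = a' \<and> b = b' \<and> c = c' \<and> (i = j \<or> a = b \<and> b = c \<and> (i = 4 \<and> j = 5 \<or> i = 5 \<and> j = 4)))"

subsection \<open>Separation of the words over two orbits\<close>

text \<open>The comparison goes through a search tree because a quadratic comparison of all words is
  too slow inside the simplifier.\<close>

datatype 'w buckets = Leaf | Node "'w buckets" "int \<times> int" "'w list" "'w buckets"

fun insert_key :: "int \<times> int \<Rightarrow> 'w \<Rightarrow> 'w buckets \<Rightarrow> 'w buckets" where
  "insert_key h w Leaf = Node Leaf h [w] Leaf"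
| "insert_key h w (Node l k ws r) =
    (if h = k then Node l k (w # ws) r
     else if fst h < fst k then Node (insert_key h w l) k ws r
     else if fst h = fst k
       then if snd h < snd k then Node (insert_key h w l) k ws r else Node l k ws (insert_key h w r)
     else Node l k ws (insert_key h w r))"

fun bucket :: "int \<times> int \<Rightarrow> 'w buckets \<Rightarrow> 'w list" where
  "bucket h Leaf = []"
| "bucket h (Node l k ws r) =
    (if h = k then ws
     else if fst h < fst k then bucket h l
     else if fst h = fst k then if snd h < snd k then bucket h l else bucket h r
     else bucket h r)"

fun all_buckets :: "('w list \<Rightarrow> bool) \<Rightarrow> 'w buckets \<Rightarrow> bool" where
  "all_buckets Q Leaf = True"
| "all_buckets Q (Node l k ws r) = (all_buckets Q l \<and> Q ws \<and> all_buckets Q r)"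

lemma bucket_insert_key:
  "bucket h (insert_key k w t) = (if h = k then w # bucket h t else bucket h t)"
  by (induction t) auto

lemma set_bucket_fold:
  "set (bucket h (fold (\<lambda>w. insert_key (key w) w) ws t)) =
    {w \<in> set ws. key w = h} \<union> set (bucket h t)"
  by (induction ws arbitrary: t) (auto simp: bucket_insert_key)

lemma all_buckets_bucket: "all_buckets Q t \<Longrightarrow> bucket h t = [] \<or> Q (bucket h t)"
  by (induction t) auto

definition all_words :: "code list \<Rightarrow> (nat \<times> code \<times> code \<times> code) list" where
  "all_words cs = List.product [1, 2, 3, 4, 5] (List.product cs (List.product cs cs))"

lemma mem_all_words:
  "(i, a, b, c) \<in> set (all_words cs) \<longleftrightarrow> i \<in> {1..5} \<and> a \<in> set cs \<and> b \<in> set cs \<and> c \<in> set cs"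
  unfolding atLeastAtMost_1_5 by (auto simp: all_words_def)

text \<open>A regular word without \<open>Del\<close> is compared with everything in its bucket,
  including words with \<open>Del\<close>: these stand for words with letters in further orbits and
  for shorter words.\<close>

definition bucket_ok :: "(nat \<times> code \<times> code \<times> code) list \<Rightarrow> bool" where
  "bucket_ok ws = list_all (\<lambda>(i, a, b, c).
     if a = Del then True else if b = Del then True else if c = Del then True
     else if regular flip i a b c then list_all (same_word (i, a, b, c)) ws else True) ws"

definition separated :: "code list \<Rightarrow> bool" where
  "separated cs = all_buckets bucket_ok
     (fold (\<lambda>w. insert_key (case w of (i, a, b, c) \<Rightarrow> wabc_value i a b c) w)
       (all_words (Del # cs)) Leaf)"

lemma separatedD:
  assumes "separated cs" and "i \<in> {1..5}" "j \<in> {1..5}"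
    and "{a, b, c} \<subseteq> set cs" "{a', b', c'} \<subseteq> insert Del (set cs)" "Del \<notin> {a, b, c}"
    and "regular flip i a b c" and val: "wabc_value i a b c = wabc_value j a' b' c'"
  shows "same_word (i, a, b, c) (j, a', b', c')"
proof -
  let ?key = "\<lambda>w. case w of (i, a, b, c) \<Rightarrow> wabc_value i a b c"
  let ?B = "bucket (wabc_value i a b c)
    (fold (\<lambda>w. insert_key (?key w) w) (all_words (Del # cs)) Leaf)"
  have mem: "(i, a, b, c) \<in> set ?B" "(j, a', b', c') \<in> set ?B"
    using assms(2-5) val by (simp_all add: set_bucket_fold mem_all_words del: atLeastAtMost_iff)
  have "?B = [] \<or> bucket_ok ?B"
    using assms(1) unfolding separated_def by (rule all_buckets_bucket)
  with mem(1) have "bucket_ok ?B" by auto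
  then have "list_all (same_word (i, a, b, c)) ?B"
    using mem(1) assms(6,7) by (auto simp: bucket_ok_def list_all_iff)
  with mem(2) show ?thesis by (simp add: list_all_iff)
qed

text \<open>The three finite checks evaluate 625, 320 and 135 words, one check for each choice of
  free and fixed orbits up to order.\<close>

lemma separated_free_free: "separated [Pos1, Neg1, Pos2, Neg2]"
  by code_simp

lemma separated_fixed_free: "separated [Fix1, Pos2, Neg2]"
  by code_simp

lemma separated_fixed_fixed: "separated [Fix1, Fix2]"
  by code_simp

section \<open>Coding the types of two orbits\<close>

definition code_of :: "('a \<Rightarrow> 'a) \<Rightarrow> 'a \<Rightarrow> 'a \<Rightarrow> 'a \<Rightarrow> code" where
  "code_of \<tau> e f x =
    (if x = e \<or> x = \<tau> e then if \<tau> e = e then Fix1 else if x = e then Pos1 else Neg1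
     else if x = f \<or> x = \<tau> f then if \<tau> f = f then Fix2 else if x = f then Pos2 else Neg2
     else Del)"

lemma code_of_involution:
  assumes inv: "\<And>x. \<tau> (\<tau> x) = x"
  shows "code_of \<tau> e f (\<tau> x) = flip (code_of \<tau> e f x)"
proof -
  have "\<tau> x = y \<longleftrightarrow> x = \<tau> y" for y using inv by metis
  note eqs = this[of e] this[of f] this[of "\<tau> e"] this[of "\<tau> f"]
  show ?thesis
    unfolding code_of_def eqs inv by (smt (verit) flip.simps)
qed

lemma code_of_inj: "\<lbrakk>code_of \<tau> e f x = code_of \<tau> e f y; code_of \<tau> e f x \<noteq> Del\<rbrakk> \<Longrightarrow> x = y"
  unfolding code_of_def by (smt (verit) code.distinct)

text \<open>Regularity is built from equations between types and their images under the involution.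
  The coding is equivariant and, away from \<open>Del\<close>, injective, so it preserves and
  reflects them.\<close>

lemma regular_code_of:
  assumes inv: "\<And>x. \<tau> (\<tau> x) = x" and "Del \<notin> {code_of \<tau> e f a, code_of \<tau> e f b, code_of \<tau> e f c}"
  shows "regular flip i (code_of \<tau> e f a) (code_of \<tau> e f b) (code_of \<tau> e f c) \<longleftrightarrow>
    regular \<tau> i a b c"
proof -
  let ?g = "code_of \<tau> e f"
  have eq: "?g x = ?g y \<longleftrightarrow> x = y" if "?g x \<noteq> Del" for x y
    using that code_of_inj by metis
  have flips: "?g x = flip (?g y) \<longleftrightarrow> x = \<tau> y" "flip (?g y) = ?g x \<longleftrightarrow> \<tau> y = x"
    if "?g x \<noteq> Del" for x y
    using eq[OF that, of "\<tau> y"] by (auto simp: code_of_involution[OF inv])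
  have nD: "?g a \<noteq> Del" "?g b \<noteq> Del" "?g c \<noteq> Del" using assms(2) by auto
  show ?thesis
    by (simp add: regular_def eq[OF nD(1)] eq[OF nD(2)] flips[OF nD(1)] flips[OF nD(3)])
qed

lemma two_orbits_code:
  assumes inv: "\<And>x. \<tau> (\<tau> x) = x" and "\<not> three_orbits \<tau> a b c"
  obtains e f cs where "separated cs" "range (code_of \<tau> e f) \<subseteq> insert Del (set cs)"
    "code_of \<tau> e f ` {a, b, c} \<subseteq> set cs" "Del \<notin> set cs"
proof -
  note thesis_intro = that
  from assms(2) consider "b \<in> {a, \<tau> a}" | "c \<in> {a, \<tau> a, b, \<tau> b}"
    unfolding three_orbits_def by blast
  then obtain e f where ef: "{a, b, c} \<subseteq> {e, \<tau> e, f, \<tau> f}"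
  proof cases
    case 1
    then show thesis using that[of a c] by auto
  next
    case 2
    then show thesis using that[of a b] by auto
  qed
  \<comment> \<open>The condition \<open>fx\<close> leaves out a free orbit followed by a fixed one,
    which no finite check covers; exchanging \<open>e\<close> and \<open>f\<close> below reduces it
    to the mixed case that is covered.\<close>
  have *: thesis if ef: "{a, b, c} \<subseteq> {e, \<tau> e, f, \<tau> f}" and fx: "\<tau> f = f \<longrightarrow> \<tau> e = e" for e f
  proof -
    have nD: "Del \<notin> code_of \<tau> e f ` {a, b, c}"
      using ef by (auto simp: code_of_def)
    have *: thesis if "separated cs" "range (code_of \<tau> e f) \<subseteq> insert Del (set cs)" "Del \<notin> set cs" for cs
    proof (rule thesis_intro[OF that(1,2) _ that(3)])
      have "code_of \<tau> e f ` {a, b, c} \<subseteq> insert Del (set cs)"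
        by (rule order_trans[OF image_mono[OF subset_UNIV] that(2)])
      then show "code_of \<tau> e f ` {a, b, c} \<subseteq> set cs"
        by (rule subset_insert[OF nD, THEN iffD1])
    qed
    consider "\<tau> e \<noteq> e" "\<tau> f \<noteq> f" | "\<tau> e = e" "\<tau> f \<noteq> f" | "\<tau> e = e" "\<tau> f = f"
      using fx by blast
    then show thesis
    proof cases
      case 1
      show thesis
        by (rule *[OF separated_free_free]) (use 1 in \<open>simp_all add: image_subset_iff code_of_def\<close>)
    next
      case 2
      show thesis
        by (rule *[OF separated_fixed_free]) (use 2 in \<open>simp_all add: image_subset_iff code_of_def\<close>)
    next
      case 3
      show thesis
        by (rule *[OF separated_fixed_fixed]) (use 3 in \<open>simp_all add: image_subset_iff code_of_def\<close>)
    qed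
  qed
  show thesis
  proof (cases "\<tau> f = f \<longrightarrow> \<tau> e = e")
    case True
    then show thesis using *[OF ef] by blast
  next
    case False
    have "{a, b, c} \<subseteq> {f, \<tau> f, e, \<tau> e}" using ef by blast
    with False show thesis using *[of f e] by blast
  qed
qed

section \<open>Classification\<close>

text \<open>Three orbits are settled by the group invariant, fewer by the coded automaton. In the
  latter case equal codes mean equal types because the codes of \<open>a\<close>, \<open>b\<close>,
  \<open>c\<close> differ from \<open>Del\<close>.\<close>

lemma classification:
  assumes inv: "\<And>x. \<tau> (\<tau> x) = x" and ij: "i \<in> {1..5}" "j \<in> {1..5}"
    and reg: "regular \<tau> i a b c"
    and hom: "homotopic \<tau> (wabc i a b c) (wabc j a' b' c')"
  shows "same_word (i, a, b, c) (j, a', b', c')"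
proof (cases "three_orbits \<tau> a b c")
  case True
  then show ?thesis
    using three_orbits_classification[OF inv _ ij hom] by (simp add: same_word_def)
next
  case False
  then obtain e f cs where cs: "separated cs" "range (code_of \<tau> e f) \<subseteq> insert Del (set cs)"
      "code_of \<tau> e f ` {a, b, c} \<subseteq> set cs" "Del \<notin> set cs"
    using two_orbits_code[OF inv] by metis
  let ?g = "code_of \<tau> e f"
  have nD: "Del \<notin> {?g a, ?g b, ?g c}" using cs(3,4) by auto
  interpret nanoword_automaton \<tau> UNIV "\<lambda>a. code_first (?g a)" "\<lambda>a. code_second (?g a)"
    by (rule nanoword_automaton.nanoword_automaton_pullback[OF nanoword_automaton_code])
      (rule code_of_involution[OF inv])
  have val: "wabc_value i (?g a) (?g b) (?g c) = wabc_value j (?g a') (?g b') (?g c')"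
    using final_state_homotopic[OF hom, of "(2, - 1)"] ij by (simp only: final_state_code UNIV_I)
  have "same_word (i, ?g a, ?g b, ?g c) (j, ?g a', ?g b', ?g c')"
  proof (rule separatedD[OF cs(1) ij _ _ nD _ val])
    show "{?g a, ?g b, ?g c} \<subseteq> set cs" using cs(3) by simp
    show "{?g a', ?g b', ?g c'} \<subseteq> insert Del (set cs)" using cs(2) by blast
    show "regular flip i (?g a) (?g b) (?g c)" using reg by (simp only: regular_code_of[OF inv nD])
  qed
  then show ?thesis
    using nD code_of_inj[of \<tau> e f] by (auto simp: same_word_def)
qed

text \<open>With at most two orbits, a word of length 0 or 4 has the value of some
  \<open>w\<^sup>1\<close> containing \<open>Del\<close>, and the finite checks separate regular
  words from those.\<close>

lemma not_homotopic_to_short: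
  assumes inv: "\<And>x. \<tau> (\<tau> x) = x" and i: "i \<in> {1..5}" and reg: "regular \<tau> i a b c"
    and hom: "homotopic \<tau> (wabc i a b c) v" and v: "is_nanoword v"
  shows "fst v \<noteq> [] \<and> length (fst v) \<noteq> 4"
proof (cases "three_orbits \<tau> a b c")
  case True
  then show ?thesis using three_orbits_length[OF inv _ i hom] by auto
next
  case False
  then obtain e f cs where cs: "separated cs" "range (code_of \<tau> e f) \<subseteq> insert Del (set cs)"
      "code_of \<tau> e f ` {a, b, c} \<subseteq> set cs" "Del \<notin> set cs"
    using two_orbits_code[OF inv] by metis
  let ?g = "code_of \<tau> e f"
  have nD: "Del \<notin> {?g a, ?g b, ?g c}" using cs(3,4) by auto
  interpret nanoword_automaton \<tau> UNIV "\<lambda>a. code_first (?g a)" "\<lambda>a. code_second (?g a)"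
    by (rule nanoword_automaton.nanoword_automaton_pullback[OF nanoword_automaton_code])
      (rule code_of_involution[OF inv])
  have val: "wabc_value i (?g a) (?g b) (?g c) =
      final_state (\<lambda>a. code_first (?g a)) (\<lambda>a. code_second (?g a)) v (2, - 1)"
    using final_state_homotopic[OF hom, of "(2, - 1)"] i by (simp only: final_state_code UNIV_I)
  text \<open>\<open>ABAB\<close> is \<open>w\<^sup>1\<close> with its third letter deleted.\<close>
  have no: "wabc_value i (?g a) (?g b) (?g c) \<noteq> wabc_value 1 a' b' Del"
    if "a' \<in> range ?g \<union> {Del}" "b' \<in> range ?g \<union> {Del}" for a' b'
  proof
    assume val': "wabc_value i (?g a) (?g b) (?g c) = wabc_value 1 a' b' Del"
    have "same_word (i, ?g a, ?g b, ?g c) (1, a', b', Del)"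
    proof (rule separatedD[OF cs(1) i _ _ _ nD _ val'])
      show "{?g a, ?g b, ?g c} \<subseteq> set cs" using cs(3) by simp
      show "{a', b', Del} \<subseteq> insert Del (set cs)" using cs(2) that by blast
      show "regular flip i (?g a) (?g b) (?g c)" using reg by (simp only: regular_code_of[OF inv nD])
    qed simp
    then show False using nD by (simp add: same_word_def)
  qed
  have start: "wabc_value 1 Del Del Del = (2, - 1)" by (simp add: wabc_value_def)
  show ?thesis
  proof (intro conjI notI)
    assume "fst v = []"
    then show False using val no[of Del Del] start by (simp add: final_state_def)
  next
    assume "length (fst v) = 4"
    then obtain A B where AB: "A \<noteq> B" "fst v \<in> {[A, B, A, B], [A, A, B, B], [A, B, B, A]}"
      using nanoword_length_4[OF v] by metis
    then consider "fst v = [A, B, A, B]" | "fst v \<in> {[A, A, B, B], [A, B, B, A]}" by blast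
    then show False
    proof cases
      case 1
      then have "final_state (\<lambda>a. code_first (?g a)) (\<lambda>a. code_second (?g a)) v (2, - 1) =
          wabc_value 1 (?g (snd v A)) (?g (snd v B)) Del"
        using AB(1) by (simp add: final_state_def wabc_value_def Let_def code_first_Del)
      then show False using val no by auto
    next
      \<comment> \<open>In \<open>AABB\<close> and \<open>ABBA\<close> each letter encloses a block
        that returns to its starting state, so \<open>G_F_self\<close> applies twice.\<close>
      case 2
      then have "final_state (\<lambda>a. code_first (?g a)) (\<lambda>a. code_second (?g a)) v (2, - 1) =
          (2, - 1)"
        using AB(1) by (auto simp: final_state_def G_F_self)
      then show False using val no[of Del Del] start by simp
    qed
  qed
qed

section \<open>The exceptional homotopy\<close>

lemma is_nanoword_wabc: "is_nanoword (wabc i a b c)"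
  by (auto simp: is_nanoword_def wabc_def)

lemma nw_iso_sym:
  assumes "nw_iso u v"
  shows "nw_iso v u"
proof -
  from assms obtain f where f: "bij_betw f (set (fst u)) (set (fst v))"
    "\<forall>A \<in> set (fst u). snd v (f A) = snd u A" "fst v = map f (fst u)"
    unfolding nw_iso_def by blast
  let ?g = "inv_into (set (fst u)) f"
  have "?g (f A) = A" if "A \<in> set (fst u)" for A
    using that f(1) by (simp add: bij_betw_inv_into_left)
  then have "\<forall>A \<in> set (fst v). snd u (?g A) = snd v A" "fst u = map ?g (fst v)"
    using f(2,3) by (auto simp: map_idI comp_def)
  with bij_betw_inv_into[OF f(1)] assms show ?thesis
    unfolding nw_iso_def by blast
qed

lemma homotopic_sym:
  assumes "homotopic \<tau> u v"
  shows "homotopic \<tau> v u"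
proof -
  have "symp (nw_step \<tau>)" by (auto simp: symp_def nw_step_def dest: nw_iso_sym)
  with assms show ?thesis
    unfolding homotopic_def by (blast dest: sympD[OF symp_rtranclp])
qed

lemma homotopic_wabc_5_4: "homotopic \<tau> (wabc 5 a a a) (wabc 4 a a a)"
proof -
  let ?v = "([1, 0, 2, 0, 2, 1], abc_proj a a a)"
  \<comment> \<open>Move (3) with \<open>x\<close>, \<open>y\<close>, \<open>z\<close>,
    \<open>t\<close> empty turns \<open>ABACBC\<close> into \<open>BACACB\<close>; exchanging the
    names of \<open>A\<close> and \<open>B\<close> gives \<open>ABCBCA\<close>.\<close>
  let ?f = "\<lambda>n::nat. if n = 0 then 1 else if n = 1 then 0 else n"
  have "nw_move \<tau> (wabc 5 a a a) ?v"
    unfolding nw_move_def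
    by (intro conjI is_nanoword_wabc disjI2 exI[of _ "[]"] exI[of _ 0] exI[of _ 1] exI[of _ 2])
      (simp_all add: wabc_def abc_proj_def)
  moreover have "nw_iso ?v (wabc 4 a a a)"
    unfolding nw_iso_def
  proof (intro conjI exI[of _ ?f])
    show "bij_betw ?f (set (fst ?v)) (set (fst (wabc 4 a a a)))"
      by (auto simp: bij_betw_def inj_on_def wabc_def)
  qed (auto simp: is_nanoword_def wabc_def abc_proj_def)
  ultimately have "nw_step \<tau> (wabc 5 a a a) ?v" "nw_step \<tau> ?v (wabc 4 a a a)"
    unfolding nw_step_def by blast+
  then show ?thesis
    unfolding homotopic_def by (rule converse_rtranclp_into_rtranclp[OF _ r_into_rtranclp])
qed

theorem theorem12p1:
  fixes \<tau> :: "'a \<Rightarrow> 'a"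
  assumes inv: "\<And>x. \<tau> (\<tau> x) = x"
  shows
    "(\<forall>i \<in> {1..5::nat}. \<forall>a b c. regular \<tau> i a b c \<longrightarrow>
        \<not> contractible \<tau> (wabc i a b c) \<and>
        \<not> (\<exists>v. is_nanoword v \<and> length (fst v) = 4 \<and> homotopic \<tau> (wabc i a b c) v))
   \<and> (\<forall>i \<in> {1..5::nat}. \<forall>a b c a' b' c'. regular \<tau> i a b c \<longrightarrow> regular \<tau> i a' b' c' \<longrightarrow>
        (homotopic \<tau> (wabc i a b c) (wabc i a' b' c') \<longleftrightarrow> a = a' \<and> b = b' \<and> c = c'))
   \<and> (\<forall>i \<in> {1..5::nat}. \<forall>j \<in> {1..5::nat}. \<forall>a b c a' b' c'. i \<noteq> j \<longrightarrow>
        regular \<tau> i a b c \<longrightarrow> regular \<tau> j a' b' c' \<longrightarrow>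
        (homotopic \<tau> (wabc i a b c) (wabc j a' b' c') \<longleftrightarrow>
           ({i, j} = {4, 5} \<and> a = b \<and> b = c \<and> a \<noteq> \<tau> a \<and> a' = a \<and> b' = b \<and> c' = c)))"
  proof (intro conjI ballI allI impI)
  fix i :: nat and a b c
  assume i: "i \<in> {1..5}" and reg: "regular \<tau> i a b c"
  note short = not_homotopic_to_short[OF inv i reg]
  show "\<not> contractible \<tau> (wabc i a b c)"
    using short by (fastforce simp: contractible_def is_nanoword_def)
  show "\<not> (\<exists>v. is_nanoword v \<and> length (fst v) = 4 \<and> homotopic \<tau> (wabc i a b c) v)"
    using short by blast
next
  fix i :: nat and a b c a' b' c'
  assume i: "i \<in> {1..5}" and reg: "regular \<tau> i a b c"
  show "homotopic \<tau> (wabc i a b c) (wabc i a' b' c') \<longleftrightarrow> a = a' \<and> b = b' \<and> c = c'"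
    using classification[OF inv i i reg, of a' b' c'] by (auto simp: same_word_def homotopic_def)
next
  fix i j :: nat and a b c a' b' c'
  assume ij: "i \<in> {1..5}" "j \<in> {1..5}" "i \<noteq> j"
    and reg: "regular \<tau> i a b c" "regular \<tau> j a' b' c'"
  show "homotopic \<tau> (wabc i a b c) (wabc j a' b' c') \<longleftrightarrow>
      ({i, j} = {4, 5} \<and> a = b \<and> b = c \<and> a \<noteq> \<tau> a \<and> a' = a \<and> b' = b \<and> c' = c)"
  proof
    assume "homotopic \<tau> (wabc i a b c) (wabc j a' b' c')"
    from classification[OF inv ij(1,2) reg(1) this] ij(3)
    have *: "a = a'" "b = b'" "c = c'" "a = b" "b = c" "i = 4 \<and> j = 5 \<or> i = 5 \<and> j = 4"
      by (auto simp: same_word_def)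
    \<comment> \<open>For equal types, 4-regularity and 5-regularity both say exactly this, so it
      does not matter which of the two indices is \<open>i\<close>.\<close>
    with reg(1) have "a \<noteq> \<tau> a" by (auto simp: regular_def)
    with * show "{i, j} = {4, 5} \<and> a = b \<and> b = c \<and> a \<noteq> \<tau> a \<and> a' = a \<and> b' = b \<and> c' = c"
      by auto
  next
    assume "{i, j} = {4, 5} \<and> a = b \<and> b = c \<and> a \<noteq> \<tau> a \<and> a' = a \<and> b' = b \<and> c' = c"
    then show "homotopic \<tau> (wabc i a b c) (wabc j a' b' c')"
      using homotopic_wabc_5_4[of \<tau> a] homotopic_sym[OF homotopic_wabc_5_4[of \<tau> a]]
      by (auto simp: doubleton_eq_iff)
  qed
qed

end
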